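(* Let $s$ be a positive integer with $s\equiv 1\pmod 2$, and let $x_1,\dots,x_n$ be independent variables. Then for all positive integers $n$ and $k$, \[ \sum _{i=0}^k(-1)^iE_i^{(s)}(x_1,\dots,x_n)\, M^{(s)}_{k-i}(x_1,\dots,x_n)=0. \]
   Context: $M_{m}^{(s)}(x_{1},\ldots,x_{n})=\sum x_{1}^{a_{1}}\cdots x_{n}^{a_{n}}$, the sum over all $n$-tuples of nonnegative integers with $a_1+\cdots+a_n=m$ and each $a_i\equiv 0$ or $1 \pmod{s+1}$. The $s$-elementary symmetric polynomial is $E_m^{(s)}(x_1,\dots,x_n)=\sum x_1^{a_1}\cdots x_n^{a_n}$, the sum over all $n$-tuples of nonnegative integers with $a_1+\cdots+a_n=m$ and each $a_i\le s$. *)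

theory Defs
  imports "HOL-Library.Poly_Mapping" "HOL-Library.FuncSet" "HOL-Number_Theory.Cong"
begin

text \<open>
  Multivariate polynomials over \<open>'a\<close> in the variables \<open>X\<^sub>0, X\<^sub>1, \<dots>\<close>: a monomial is a finitely
  supported exponent function on the variable indices, a polynomial a finitely supported
  function from monomials to coefficients. The multiplication of \<^theory>\<open>HOL-Library.Poly_Mapping\<close>
  is convolution, so this is the usual polynomial ring.
\<close>

type_synonym 'a mpolynomial = "(nat \<Rightarrow>\<^sub>0 nat) \<Rightarrow>\<^sub>0 'a"

definition indet :: "nat \<Rightarrow> 'a::comm_ring_1 mpolynomial" where
  "indet i = Poly_Mapping.single (Poly_Mapping.single i 1) 1"

text \<open>
  An \<open>n\<close>-tuple \<open>(a\<^sub>1, \<dots>, a\<^sub>n)\<close> is a function that is extensional on \<open>{1..n}\<close> (a fixed dummy value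
  elsewhere), so that each tuple is represented exactly once.
\<close>

definition exponent_tuples :: "nat \<Rightarrow> nat \<Rightarrow> (nat \<Rightarrow> nat) set" where
  "exponent_tuples n m = {a \<in> extensional {1..n}. (\<Sum>j = 1..n. a j) = m}"

definition E_sym :: "nat \<Rightarrow> nat \<Rightarrow> nat \<Rightarrow> (nat \<Rightarrow> 'b::comm_ring_1) \<Rightarrow> 'b" where
  "E_sym s n m x =
     (\<Sum>a \<in> {a \<in> exponent_tuples n m. \<forall>j\<in>{1..n}. a j \<le> s}. \<Prod>j = 1..n. x j ^ a j)"

definition M_sym :: "nat \<Rightarrow> nat \<Rightarrow> nat \<Rightarrow> (nat \<Rightarrow> 'b::comm_ring_1) \<Rightarrow> 'b" where
  "M_sym s n m x =
     (\<Sum>a \<in> {a \<in> exponent_tuples n m.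
              \<forall>j\<in>{1..n}. [a j = 0] (mod (s + 1)) \<or> [a j = 1] (mod (s + 1))}.
        \<Prod>j = 1..n. x j ^ a j)"

text \<open>The index sets are finite, so the sums above are not the default value \<open>0\<close>.\<close>

lemma finite_exponent_tuples: "finite (exponent_tuples n m)"
proof (rule finite_subset)
  show "exponent_tuples n m \<subseteq> {1..n} \<rightarrow>\<^sub>E {..m}"
  proof
    fix a assume a: "a \<in> exponent_tuples n m"
    then have "a j \<le> m" if "j \<in> {1..n}" for j
      using member_le_sum[of j "{1..n}" a] that by (simp add: exponent_tuples_def)
    with a show "a \<in> {1..n} \<rightarrow>\<^sub>E {..m}"
      by (simp add: exponent_tuples_def PiE_iff)
  qed
  show "finite ({1..n} \<rightarrow>\<^sub>E {..m})"
    by (intro finite_PiE) auto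
qed

end

theory Submission
  imports Defs "HOL-Computational_Algebra.Formal_Power_Series"
begin

text \<open>
  Both families have generating functions that factor over the variables. Hence the alternating
  sum is the coefficient of \<open>t ^ k\<close> in \<open>\<Prod>\<^sub>j F (x\<^sub>j t) G (x\<^sub>j t)\<close>, where \<open>F y = 1 - y + \<dots> + (- y) ^ s\<close> and
  \<open>G y = (1 + y) / (1 - y ^ (s + 1))\<close>. For odd \<open>s\<close>, \<open>F y (1 + y) = 1 - y ^ (s + 1)\<close>, so every
  factor is 1.
\<close>

lemma exponent_tuples_0: "exponent_tuples 0 m = (if m = 0 then {\<lambda>_. undefined} else {})"
  by (auto simp: exponent_tuples_def extensional_def fun_eq_iff)

text \<open>Splits off the last entry \<open>i\<close>, leaving total \<open>m - i\<close> for the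
  others, which is the index pattern of a Cauchy product. The inverse resets position
  \<open>Suc n\<close> to \<open>undefined\<close> so that the shorter tuple is again extensional on
  \<open>{1..n}\<close>.\<close>

lemma bij_betw_exponent_tuples_Suc:
  "bij_betw (\<lambda>(i, a). a(Suc n := i)) (SIGMA i:{0..m}. exponent_tuples n (m - i))
     (exponent_tuples (Suc n) m)"
proof (rule bij_betw_byWitness[where f' = "\<lambda>a. (a (Suc n), a(Suc n := undefined))"])
  show "(\<lambda>(i, a). a(Suc n := i)) ` (SIGMA i:{0..m}. exponent_tuples n (m - i))
          \<subseteq> exponent_tuples (Suc n) m"
    by (auto simp: exponent_tuples_def extensional_def)
  show "(\<lambda>a. (a (Suc n), a(Suc n := undefined))) ` exponent_tuples (Suc n) m
          \<subseteq> (SIGMA i:{0..m}. exponent_tuples n (m - i))"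
    by (auto simp: exponent_tuples_def extensional_def)
qed (auto simp: exponent_tuples_def extensional_def fun_eq_iff)

text \<open>Induction on \<open>n\<close>: the Cauchy product with the last factor sums over the
  exponent of that factor and a tuple for the rest, and the bijection above merges the two
  sums.\<close>

lemma fps_nth_prod_exponent_tuples:
  fixes f :: "nat \<Rightarrow> 'b::comm_ring_1 fps"
  shows "fps_nth (\<Prod>j = 1..n. f j) m = (\<Sum>a \<in> exponent_tuples n m. \<Prod>j = 1..n. fps_nth (f j) (a j))"
proof (induction n arbitrary: m)
  case 0
  show ?case by (simp add: exponent_tuples_0)
next
  case (Suc n)
  have "fps_nth (\<Prod>j = 1..Suc n. f j) m
      = (\<Sum>i = 0..m. \<Sum>a \<in> exponent_tuples n (m - i). fps_nth (f (Suc n)) i * (\<Prod>j = 1..n. fps_nth (f j) (a j)))"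
    by (simp add: fps_mult_nth Suc.IH[simplified] sum_distrib_left mult.commute[of "prod f _"])
  also have "\<dots> = (\<Sum>(i, a) \<in> (SIGMA i:{0..m}. exponent_tuples n (m - i)).
      fps_nth (f (Suc n)) i * (\<Prod>j = 1..n. fps_nth (f j) (a j)))"
    by (simp add: sum.Sigma finite_exponent_tuples)
  also have "\<dots> = (\<Sum>(i, a) \<in> (SIGMA i:{0..m}. exponent_tuples n (m - i)).
      \<Prod>j = 1..Suc n. fps_nth (f j) ((a(Suc n := i)) j))"
    by (intro sum.cong refl) (auto simp: mult.commute intro!: prod.cong)
  also have "\<dots> = (\<Sum>a \<in> exponent_tuples (Suc n) m. \<Prod>j = 1..Suc n. fps_nth (f j) (a j))"
    by (simp only: sum.reindex_bij_betw[OF bij_betw_exponent_tuples_Suc, symmetric] case_prod_unfold)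
  finally show ?case .
qed

lemma prod_if_zero:
  fixes c :: "'i \<Rightarrow> 'b::comm_semiring_1"
  assumes "finite A"
  shows "(\<Prod>j\<in>A. if P j then c j else 0) = (if \<forall>j\<in>A. P j then \<Prod>j\<in>A. c j else 0)"
  using assms by (induction A rule: finite_induct) auto

text \<open>A restriction on exponents is encoded by zero coefficients: a tuple with one forbidden
  entry contributes a zero product. Both symmetric families are instances, with different
  \<open>P\<close>.\<close>

lemma fps_nth_prod_restricted:
  fixes x :: "nat \<Rightarrow> 'b::comm_ring_1"
  shows "fps_nth (\<Prod>j = 1..n. Abs_fps (\<lambda>a. if P a then x j ^ a else 0)) m
    = (\<Sum>a \<in> {a \<in> exponent_tuples n m. \<forall>j\<in>{1..n}. P (a j)}. \<Prod>j = 1..n. x j ^ a j)"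
  unfolding fps_nth_prod_exponent_tuples fps_nth_Abs_fps
  by (subst sum.inter_filter[OF finite_exponent_tuples])
     (intro sum.cong refl, rule prod_if_zero, simp)

lemma M_sym_eq_fps_nth:
  "M_sym s n m x = fps_nth (\<Prod>j = 1..n.
     Abs_fps (\<lambda>a. if [a = 0] (mod (s + 1)) \<or> [a = 1] (mod (s + 1)) then x j ^ a else 0)) m"
  unfolding M_sym_def fps_nth_prod_restricted ..

text \<open>Homogeneity of degree \<open>m\<close>. It moves the alternating sign into the
  variables, where the generating function still factors.\<close>

lemma E_sym_uminus: "E_sym s n m (\<lambda>j. - x j) = (- 1) ^ m * E_sym s n m x"
  unfolding E_sym_def sum_distrib_left
proof (intro sum.cong refl)
  fix a assume "a \<in> {a \<in> exponent_tuples n m. \<forall>j\<in>{1..n}. a j \<le> s}"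
  then have "(\<Sum>j = 1..n. a j) = m" by (simp add: exponent_tuples_def)
  then show "(\<Prod>j = 1..n. (- x j) ^ a j) = (- 1) ^ m * (\<Prod>j = 1..n. x j ^ a j)"
    by (simp add: power_minus[of "x _"] prod.distrib power_sum[symmetric])
qed

lemma alternating_E_sym_eq_fps_nth:
  "(- 1) ^ m * E_sym s n m x = fps_nth (\<Prod>j = 1..n. Abs_fps (\<lambda>a. if a \<le> s then (- x j) ^ a else 0)) m"
  unfolding fps_nth_prod_restricted by (simp only: E_sym_uminus[symmetric]) (simp only: E_sym_def)

lemma cong_diff_nat_iff:
  fixes i m N :: nat
  assumes "i < N" "i \<le> m"
  shows "[m - i = 0] (mod N) \<longleftrightarrow> i = m mod N"
  using assms by (auto simp: cong_0_iff mod_eq_dvd_iff_nat[symmetric])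

text \<open>
  The coefficient of degree \<open>m > 0\<close> has just two nonzero terms, \<open>i = m mod (s + 1)\<close> and
  \<open>i = (m - 1) mod (s + 1)\<close>; they cancel because reduction modulo the even number \<open>s + 1\<close>
  preserves parity.
\<close>
lemma fps_truncated_geometric_mult:
  fixes x :: "'b::comm_ring_1"
  assumes "odd s"
  shows "Abs_fps (\<lambda>a. if a \<le> s then (- x) ^ a else 0)
       * Abs_fps (\<lambda>a. if [a = 0] (mod (s + 1)) \<or> [a = 1] (mod (s + 1)) then x ^ a else 0) = 1"
    (is "?F * ?G = 1")
proof (rule fps_ext)
  fix m :: nat
  show "fps_nth (?F * ?G) m = fps_nth 1 m"
  proof (cases m)
    case 0
    then show ?thesis by (simp add: cong_def)
  next
    case (Suc l)
    define I where "I = {i \<in> {0..m}. i \<le> s \<and> ([m - i = 0] (mod (s + 1)) \<or> [m - i = 1] (mod (s + 1)))}"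
    have parity: "even (a mod (s + 1)) \<longleftrightarrow> even a" for a
      using \<open>odd s\<close> by (simp add: dvd_mod_iff)
    have "I = {m mod (s + 1), l mod (s + 1)}"
    proof -
      have "i \<in> I \<longleftrightarrow> i = m mod (s + 1) \<or> i = l mod (s + 1)" for i
      proof (cases "i \<le> s \<and> i \<le> m")
        case True
        have "[m - i = 1] (mod (s + 1)) \<longleftrightarrow> i = l mod (s + 1)"
        \<comment> \<open>For \<open>i = m\<close> the shift from \<open>m - i\<close> to
          \<open>l - i\<close> fails, as subtraction truncates. Both sides are then false: 0 and 1
          differ modulo \<open>s + 1\<close>, which is at least 2, and \<open>l mod (s + 1)\<close>
          is at most \<open>l\<close>, hence below \<open>m\<close>.\<close>
        proof (cases "i = m")
          case True
          have "\<not> [0 = 1] (mod (s + 1))"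
            using odd_pos[OF \<open>odd s\<close>] by (simp add: cong_def)
          moreover have "l mod (s + 1) < m"
            using mod_less_eq_dividend[of l "s + 1"] Suc by linarith
          ultimately show ?thesis
            using True by auto
        next
          case False
          with True Suc have "i \<le> l" "m - i = (l - i) + 1"
            by auto
          then have "[m - i = 1] (mod (s + 1)) \<longleftrightarrow> [l - i = 0] (mod (s + 1))"
            using cong_add_rcancel_nat[of "l - i" 1 0 "s + 1"] by simp
          with \<open>i \<le> l\<close> True show ?thesis
            by (simp add: cong_diff_nat_iff)
        qed
        with True show ?thesis
          by (auto simp: I_def cong_diff_nat_iff)
      next
        case False
        \<comment> \<open>Both residues lie within the bounds \<open>s\<close> and \<open>m\<close>,
          so an \<open>i\<close> outside them is neither a residue nor in \<open>I\<close>.\<close>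
        moreover have "a mod (s + 1) \<le> s" "a mod (s + 1) \<le> a" for a
          using mod_less_divisor[of "s + 1" a] by auto
        ultimately show ?thesis
          using Suc by (auto simp: I_def intro: le_SucI)
      qed
      then show ?thesis by auto
    qed
    \<comment> \<open>If the residues coincided, \<open>I\<close> would be a singleton and nothing
      would cancel.\<close>
    moreover have "m mod (s + 1) \<noteq> l mod (s + 1)"
      using parity[of m] parity[of l] Suc by auto
    \<comment> \<open>Every surviving term is \<open>x ^ m\<close> up to sign, since the exponents
      \<open>i\<close> and \<open>m - i\<close> add up to \<open>m\<close>.\<close>
    moreover have "fps_nth (?F * ?G) m = (\<Sum>i\<in>I. (- 1) ^ i * x ^ m)"
    proof -
      have "fps_nth (?F * ?G) m = (\<Sum>i = 0..m. if i \<le> s \<and>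
          ([m - i = 0] (mod (s + 1)) \<or> [m - i = 1] (mod (s + 1))) then (- 1) ^ i * x ^ m else 0)"
        unfolding fps_mult_nth fps_nth_Abs_fps
        by (intro sum.cong refl)
           (auto simp: power_minus[of x] mult.assoc power_add[symmetric])
      then show ?thesis
        unfolding I_def by (simp only: sum.inter_filter[OF finite_atLeastAtMost])
    qed
    moreover have "(- 1) ^ (m mod (s + 1)) = - ((- 1) ^ (l mod (s + 1)) :: 'b)"
      using parity[of m] parity[of l] Suc by (cases "even l") auto
    ultimately show ?thesis
      using Suc by simp
  qed
qed

theorem theorem5p1:
  fixes s n k :: nat
  assumes "s > 0" and "[s = 1] (mod 2)" and "n > 0" and "k > 0"
  shows "(\<Sum>i = 0..k. (- 1) ^ i * E_sym s n i indet * M_sym s n (k - i) indet)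
         = (0 :: 'a::comm_ring_1 mpolynomial)"
proof -
  have "odd s"
    using assms(2) by (simp add: cong_def odd_iff_mod_2_eq_one)
  let ?x = "indet :: nat \<Rightarrow> 'a mpolynomial"
  let ?F = "\<lambda>j. Abs_fps (\<lambda>a. if a \<le> s then (- ?x j) ^ a else 0)"
  let ?G = "\<lambda>j. Abs_fps (\<lambda>a. if [a = 0] (mod (s + 1)) \<or> [a = 1] (mod (s + 1)) then ?x j ^ a else 0)"
  have "(\<Sum>i = 0..k. (- 1) ^ i * E_sym s n i ?x * M_sym s n (k - i) ?x)
      = fps_nth ((\<Prod>j = 1..n. ?F j) * (\<Prod>j = 1..n. ?G j)) k"
    by (simp only: fps_mult_nth alternating_E_sym_eq_fps_nth M_sym_eq_fps_nth)
  also have "(\<Prod>j = 1..n. ?F j) * (\<Prod>j = 1..n. ?G j) = (\<Prod>j = 1..n. ?F j * ?G j)"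
    by (rule prod.distrib[symmetric])
  also have "\<dots> = 1"
    by (simp only: fps_truncated_geometric_mult[OF \<open>odd s\<close>] prod.neutral_const)
  also have "fps_nth 1 k = (0 :: 'a mpolynomial)"
    using \<open>k > 0\<close> by simp
  finally show ?thesis .
qed

end
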